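(* Let $\alpha\in(0,\pi/2)$ and define $$\beta_0(\alpha)=\begin{cases}\alpha & \text{if } \alpha\in(0,\pi/6],\\ \tfrac12\arccos\!\left(\dfrac{-2\cos(4\alpha)+\cos(6\alpha)+2}{3-2\cos(4\alpha)}\right) & \text{if } \alpha\in(\pi/6,\pi/3),\\ 0 & \text{if } \alpha\in[\pi/3,\pi/2).\end{cases}$$ Then $\beta=\beta_0(\alpha)$ minimizes, over $\beta\in[0,\alpha]$, the competitive ratio of the $\beta$-Hedge algorithm with parameter $\beta$, and with this choice the competitive ratio equals $$\rho(\beta\text{-Hedge};\alpha)=\begin{cases}1/\cos\alpha & \text{if } \alpha\in(0,\pi/6),\\ f_1(\alpha,\beta_0,r_0(\alpha,\beta_0)) & \text{if } \alpha\in[\pi/6,\pi/3],\\ 1/\sin\alpha & \text{if } \alpha\in[\pi/3,\pi/2).\end{cases}$$ This bound is tight: it is attained by the adversarial choice $r=r_0(\alpha,\beta_0)$ of the right extent of the good input, where in particular $r_0=1$ if $\alpha\le\pi/6$ and $r_0=-\cos(2\alpha)$ if $\alpha\ge\pi/3$.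
   Context: Online drone coverage on a line. A drone has a fixed half angle-of-view $\alpha\in(0,\pi/2)$. A drone at a point $T=(t_x,t_y)$ with $t_y\ge 0$ covers the segment $[t_x-t_y\tan\alpha,\ t_x+t_y\tan\alpha]$ of the $x$-axis. For a point $X=(x,0)$ its feasibility cone is $\mathrm{FC}(X)=\{(u,v): v\ge 0,\ |u-x|\le v\tan\alpha\}$, and the feasibility cone of a finite set of points on the $x$-axis is the intersection of their cones. An input is a sequence of points $X_0=(0,0),X_1,\dots,X_n$ ($n\ge1$) on the $x$-axis, $X_i=(x_i,0)$, revealed one at a time. A solution is a sequence of drone positions $P_0=(0,0),P_1,\dots,P_n$ with $P_i\in \mathrm{FC}(X_0,\dots,X_i)$; its cost is $\sum_{i=0}^{n-1}|P_iP_{i+1}|$ (Euclidean). An online algorithm chooses $P_i$ knowing only $X_0,\dots,X_i$. $\mathrm{OPT}(\mathbf X;\alpha)$ is the minimum cost of a solution when the whole input is known in advance. A request $X_{i+1}$ is redundant if $x_{i+1}\in[\min_{j\le i}x_j,\max_{j\le i}x_j]$. An input is good if it has no redundant requests and is scaled (and possibly reflected) so that $\min_j x_j=-1$ and $r:=\max_j x_j\in[0,1]$. The competitive ratio is the supremum over good inputs of $\mathrm{ALG}(\mathbf X;\alpha)/\mathrm{OPT}(\mathbf X;\alpha)$. The $\beta$-Hedge algorithm with parameter $\beta\in[0,\alpha]$: if $P_{i-1}\in\mathrm{FC}(X_0,\dots,X_i)$ then $P_i=P_{i-1}$; otherwise the drone moves from $P_{i-1}$ along the ray making angle $\beta$ with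 the upward vertical and tilted toward the side of the new request (direction $(\operatorname{sgn}(x_i)\sin\beta,\cos\beta)$), and $P_i$ is the first point of this ray lying in $\mathrm{FC}(X_0,\dots,X_i)$. Define, for $\beta\in[0,\alpha]$ and $r\in[0,1]$, $$f_1(\alpha,\beta,r)=\frac{2\sin\alpha}{\cos\beta(\tan\alpha+\tan\beta)}\cdot\frac{1+\frac{2\tan\beta}{\tan\alpha+\tan\beta}\,r}{\sqrt{1+r^2+2\cos(2\alpha)\,r}},$$ and with $A=\frac{2\tan\beta}{\tan\alpha+\tan\beta}$, $B=2\cos(2\alpha)$, let $r_0(\alpha,\beta)=\frac{2A-B}{2-AB}$. *)

theory Defs
  imports "HOL-Analysis.Analysis"
begin

text \<open>Feasibility cone of a point (x,0) for half angle-of-view a.\<close>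
definition FC :: "real \<Rightarrow> real \<Rightarrow> (real \<times> real) set" where
  "FC a x = {(u, v). v \<ge> 0 \<and> \<bar>u - x\<bar> \<le> v * tan a}"

definition FCs :: "real \<Rightarrow> (nat \<Rightarrow> real) \<Rightarrow> nat \<Rightarrow> (real \<times> real) set" where
  "FCs a xs i = (\<Inter>j\<in>{..i}. FC a (xs j))"

definition is_solution :: "real \<Rightarrow> nat \<Rightarrow> (nat \<Rightarrow> real) \<Rightarrow> (nat \<Rightarrow> real \<times> real) \<Rightarrow> bool" where
  "is_solution a n xs P \<longleftrightarrow> P 0 = (0, 0) \<and> (\<forall>i\<le>n. P i \<in> FCs a xs i)"

text \<open>Euclidean travel cost (dist on real \<times> real is the Euclidean distance).\<close>
definition cost :: "nat \<Rightarrow> (nat \<Rightarrow> real \<times> real) \<Rightarrow> real" where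
  "cost n P = (\<Sum>i<n. dist (P i) (P (Suc i)))"

definition OPT :: "real \<Rightarrow> nat \<Rightarrow> (nat \<Rightarrow> real) \<Rightarrow> real" where
  "OPT a n xs = Inf {cost n P | P. is_solution a n xs P}"

primrec hedge_pos :: "real \<Rightarrow> real \<Rightarrow> (nat \<Rightarrow> real) \<Rightarrow> nat \<Rightarrow> real \<times> real" where
  "hedge_pos a b xs 0 = (0, 0)"
| "hedge_pos a b xs (Suc i) =
     (let Q = hedge_pos a b xs i;
          d = (sgn (xs (Suc i)) * sin b, cos b)
      in if Q \<in> FCs a xs (Suc i) then Q
         else Q + Inf {t. t \<ge> 0 \<and> Q + t *\<^sub>R d \<in> FCs a xs (Suc i)} *\<^sub>R d)"

definition hedge_cost :: "real \<Rightarrow> real \<Rightarrow> nat \<Rightarrow> (nat \<Rightarrow> real) \<Rightarrow> real" where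
  "hedge_cost a b n xs = cost n (hedge_pos a b xs)"

definition good_input :: "nat \<Rightarrow> (nat \<Rightarrow> real) \<Rightarrow> bool" where
  "good_input n xs \<longleftrightarrow> n \<ge> 1 \<and> xs 0 = 0 \<and>
     (\<forall>i<n. xs (Suc i) \<notin> {Min (xs ` {..i}) .. Max (xs ` {..i})}) \<and>
     Min (xs ` {..n}) = -1 \<and> Max (xs ` {..n}) \<in> {0..1}"

definition hedge_ratio :: "real \<Rightarrow> real \<Rightarrow> ereal" where
  "hedge_ratio a b = (SUP p \<in> {(n, xs). good_input n xs}.
       ereal (hedge_cost a b (fst p) (snd p) / OPT a (fst p) (snd p)))"

definition hedge_ratio_at :: "real \<Rightarrow> real \<Rightarrow> real \<Rightarrow> ereal" where
  "hedge_ratio_at a b r = (SUP p \<in> {(n, xs). good_input n xs \<and> Max (xs ` {..n}) = r}.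
       ereal (hedge_cost a b (fst p) (snd p) / OPT a (fst p) (snd p)))"

definition f1 :: "real \<Rightarrow> real \<Rightarrow> real \<Rightarrow> real" where
  "f1 a b r = 2 * sin a / (cos b * (tan a + tan b)) *
      ((1 + 2 * tan b / (tan a + tan b) * r) / sqrt (1 + r^2 + 2 * cos (2 * a) * r))"

definition r0 :: "real \<Rightarrow> real \<Rightarrow> real" where
  "r0 a b = (let A = 2 * tan b / (tan a + tan b); B = 2 * cos (2 * a) in (2 * A - B) / (2 - A * B))"

definition beta0 :: "real \<Rightarrow> real" where
  "beta0 a = (if a \<le> pi / 6 then a
     else if a < pi / 3 then
       arccos ((- 2 * cos (4 * a) + cos (6 * a) + 2) / (3 - 2 * cos (4 * a))) / 2
     else 0)"

definition rho_opt :: "real \<Rightarrow> real" where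
  "rho_opt a = (if a < pi / 6 then 1 / cos a
     else if a \<le> pi / 3 then f1 a (beta0 a) (r0 a (beta0 a))
     else 1 / sin a)"

end

theory Submission
  imports Defs
begin

text \<open>
  In the coordinates \<open>p = v tan a + u\<close>, \<open>q = v tan a - u\<close> a position covers the segment
  \<open>[-q, p]\<close>, and a hedge move raises both coordinates at fixed rates. Hence, among good inputs with
  right extent \<open>r\<close>, requesting \<open>r\<close> and then \<open>-1\<close> is the most expensive for the hedge, while the
  optimum moves straight to the nearest point of the final feasibility cone and depends on \<open>r\<close>
  only. The ratio as a function of \<open>r\<close> is maximal at \<open>r0\<close>, by Cauchy--Schwarz; in
  \<open>T = tan a\<close> and \<open>t = tan b\<close> its squared maximum is
  \<open>(1 + t\<^sup>2) ((T - t)\<^sup>2 + T\<^sup>2 (T + 3t)\<^sup>2) / (T + t)\<^sup>4\<close>. On \<open>[0, T]\<close> its derivative has the sign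
  of \<open>(1 + 5T\<^sup>2) t - T (3 - T\<^sup>2)\<close>, so the minimum is at the projection of
  \<open>T (3 - T\<^sup>2) / (1 + 5T\<^sup>2)\<close> onto \<open>[0, T]\<close>, which is \<open>tan (beta0 a)\<close>.
\<close>

section \<open>Cost of the hedge\<close>

declare hedge_pos.simps(2) [simp del]

section \<open>Cones and hedge moves in the coordinates p and q\<close>

definition hi :: "(nat \<Rightarrow> real) \<Rightarrow> nat \<Rightarrow> real" where
  "hi xs i = Max (xs ` {..i})"

definition lo :: "(nat \<Rightarrow> real) \<Rightarrow> nat \<Rightarrow> real" where
  "lo xs i = Min (xs ` {..i})"

lemma hi_Suc: "hi xs (Suc i) = max (xs (Suc i)) (hi xs i)"
  by (simp add: hi_def atMost_Suc)

lemma hi_0 [simp]: "hi xs 0 = xs 0" and lo_0 [simp]: "lo xs 0 = xs 0"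
  by (simp_all add: hi_def lo_def)

lemma lo_Suc: "lo xs (Suc i) = min (xs (Suc i)) (lo xs i)"
  by (simp add: lo_def atMost_Suc)

lemma good_input_iff:
  "good_input n xs \<longleftrightarrow> n \<ge> 1 \<and> xs 0 = 0 \<and>
     (\<forall>i<n. xs (Suc i) \<notin> {lo xs i..hi xs i}) \<and> lo xs n = -1 \<and> hi xs n \<in> {0..1}"
  by (simp only: good_input_def hi_def lo_def)

lemma hi_nonneg: "xs 0 = 0 \<Longrightarrow> 0 \<le> hi xs i"
  unfolding hi_def by (rule Max_ge) (auto simp: image_iff intro: bexI[of _ 0])

lemma lo_nonpos: "xs 0 = 0 \<Longrightarrow> lo xs i \<le> 0"
  unfolding lo_def by (rule Min_le) (auto simp: image_iff intro: bexI[of _ 0])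

text \<open>Only the extreme requests bind, and \<open>0 < tan a\<close> makes
  \<open>0 \<le> v\<close> follow from the remaining bounds. So the cone is a quadrant in p and
  q.\<close>

lemma FCs_iff:
  assumes "0 < tan a" and "xs 0 = 0"
  shows "(u, v) \<in> FCs a xs i \<longleftrightarrow> hi xs i \<le> v * tan a + u \<and> - lo xs i \<le> v * tan a - u"
proof -
  have "(u, v) \<in> FCs a xs i \<longleftrightarrow> (\<forall>j\<le>i. 0 \<le> v \<and> \<bar>u - xs j\<bar> \<le> v * tan a)"
    by (auto simp: FCs_def FC_def)
  also have "\<dots> \<longleftrightarrow> (\<forall>j\<le>i. \<bar>u - xs j\<bar> \<le> v * tan a)"
  proof -
    have "0 \<le> v" if "\<forall>j\<le>i. \<bar>u - xs j\<bar> \<le> v * tan a"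
    proof -
      have "0 \<le> v * tan a" using that assms(2) by (metis abs_ge_zero le0 order_trans)
      then show ?thesis using assms(1) by (simp add: zero_le_mult_iff)
    qed
    then show ?thesis by blast
  qed
  also have "\<dots> \<longleftrightarrow> (\<forall>j\<le>i. xs j \<le> v * tan a + u) \<and> (\<forall>j\<le>i. u - v * tan a \<le> xs j)"
    by (force simp: abs_le_iff)
  also have "\<dots> \<longleftrightarrow> hi xs i \<le> v * tan a + u \<and> u - v * tan a \<le> lo xs i"
    by (auto simp: hi_def lo_def Max_le_iff Min_ge_iff)
  finally show ?thesis by linarith
qed

text \<open>The sign \<open>e\<close> handles both sides at once: \<open>X\<close> bounds the end
  that the ray tilts to, \<open>Y\<close> the other end. By \<open>z\<close> the other end never
  recedes, so the move only has to make up the deficit in \<open>X\<close>; the \<open>max 0\<close>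
  covers a drone that stays.\<close>

lemma hedge_step:
  assumes w: "0 < tan a * cos b + sin b" and z: "0 \<le> tan a * cos b - sin b"
    and e: "e = 1 \<or> e = -1" "sgn (xs (Suc i)) = e"
    and Q: "hedge_pos a b xs i = (u, v)"
    and FC: "\<And>u v. (u, v) \<in> FCs a xs (Suc i) \<longleftrightarrow> X \<le> v * tan a + e * u \<and> Y \<le> v * tan a - e * u"
    and Y: "Y \<le> v * tan a - e * u"
    and t: "t = max 0 ((X - (v * tan a + e * u)) / (tan a * cos b + sin b))"
  shows "hedge_pos a b xs (Suc i) = (u + t * e * sin b, v + t * cos b)"
    and "dist (hedge_pos a b xs i) (hedge_pos a b xs (Suc i)) = t"
proof -
  have ee: "e * e = 1" using e by auto
  show pos: "hedge_pos a b xs (Suc i) = (u + t * e * sin b, v + t * cos b)"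
  proof (cases "X \<le> v * tan a + e * u")
    case True
    then have "(X - (v * tan a + e * u)) / (tan a * cos b + sin b) \<le> 0"
      using w by (simp add: divide_nonpos_pos)
    then have "t = 0" using t by simp
    then show ?thesis using True Y by (simp add: Q FC hedge_pos.simps(2))
  next
    case False
    then have t': "t = (X - (v * tan a + e * u)) / (tan a * cos b + sin b)"
      using w t by (simp add: max_def divide_simps)
    then have t0: "0 < t" using False w by simp
    \<comment> \<open>The feasible parameters form the closed half-line from \<open>t\<close>, so
      the \<open>Inf\<close> in the algorithm is \<open>t\<close>.\<close>
    have "{s. s \<ge> 0 \<and> (u, v) + s *\<^sub>R (e * sin b, cos b) \<in> FCs a xs (Suc i)} = {t..}"
    proof (intro equalityI subsetI)
      fix s assume "s \<in> {s. s \<ge> 0 \<and> (u, v) + s *\<^sub>R (e * sin b, cos b) \<in> FCs a xs (Suc i)}"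
      then have "X \<le> (v + s * cos b) * tan a + e * (u + s * (e * sin b))"
        by (simp add: FC)
      also have "\<dots> = v * tan a + e * u + s * (tan a * cos b + (e * e) * sin b)"
        by (simp add: algebra_simps)
      finally show "s \<in> {t..}" using w ee by (simp add: t' pos_divide_le_eq algebra_simps)
    next
      fix s assume s: "s \<in> {t..}"
      then have s0: "0 \<le> s" using t0 by simp
      have "X \<le> v * tan a + e * u + s * (tan a * cos b + (e * e) * sin b)"
        using s w ee by (simp add: t' pos_divide_le_eq algebra_simps)
      also have "\<dots> = (v + s * cos b) * tan a + e * (u + s * (e * sin b))"
        by (simp add: algebra_simps)
      finally have 1: "X \<le> (v + s * cos b) * tan a + e * (u + s * (e * sin b))" .
      have "0 \<le> s * (tan a * cos b - (e * e) * sin b)" using s0 z ee by simp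
      then have "Y \<le> v * tan a - e * u + s * (tan a * cos b - (e * e) * sin b)" using Y by linarith
      also have "\<dots> = (v + s * cos b) * tan a - e * (u + s * (e * sin b))"
        by (simp add: algebra_simps)
      finally show "s \<in> {s. s \<ge> 0 \<and> (u, v) + s *\<^sub>R (e * sin b, cos b) \<in> FCs a xs (Suc i)}"
        using 1 s0 by (simp add: FC)
    qed
    then show ?thesis using False e(2) by (simp add: Q FC Let_def hedge_pos.simps(2))
  qed
  have "0 \<le> t" using t by simp
  \<comment> \<open>The direction is a unit vector, so \<open>t\<close> is the distance
    travelled.\<close>
  have "(t * e * sin b)\<^sup>2 + (t * cos b)\<^sup>2 = t\<^sup>2 * ((e * e) * (sin b)\<^sup>2 + (cos b)\<^sup>2)"
    by (simp add: power2_eq_square algebra_simps)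
  then show "dist (hedge_pos a b xs i) (hedge_pos a b xs (Suc i)) = t"
    unfolding pos Q using ee \<open>0 \<le> t\<close> by (simp add: dist_prod_def dist_real_def)
qed

text \<open>Here \<open>x\<close> and \<open>y\<close> are the distances travelled so far on right-tilted and left-tilted rays.
  Per unit length a ray extends the covered segment by \<open>w\<close> on the side it tilts to and by \<open>z\<close> on
  the other side. The final disjunction holds because, on the side of the last move, the
  covered segment does not reach beyond the extreme request.\<close>

lemma hedge_invariant:
  assumes T: "0 < tan a" and w: "0 < w" "w = tan a * cos b + sin b"
    and z: "0 \<le> z" "z = tan a * cos b - sin b"
    and xs: "xs 0 = 0" and nonred: "\<And>i. i < n \<Longrightarrow> xs (Suc i) \<notin> {lo xs i..hi xs i}"
    and "i \<le> n"
  shows "\<exists>x y. 0 \<le> x \<and> 0 \<le> y \<and> hedge_pos a b xs i = ((x - y) * sin b, (x + y) * cos b)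
    \<and> cost i (hedge_pos a b xs) = x + y
    \<and> hi xs i \<le> w * x + z * y \<and> - lo xs i \<le> z * x + w * y
    \<and> w * x \<le> hi xs i \<and> w * y \<le> - lo xs i
    \<and> (z * x + w * y \<le> - lo xs i \<or> w * x + z * y \<le> hi xs i)"
  using \<open>i \<le> n\<close>
proof (induction i)
  case 0
  show ?case by (intro exI[of _ 0]) (simp add: xs cost_def)
next
  case (Suc i)
  then obtain x y where xy: "0 \<le> x" "0 \<le> y"
    and P: "hedge_pos a b xs i = ((x - y) * sin b, (x + y) * cos b)"
    and C: "cost i (hedge_pos a b xs) = x + y"
    and p: "hi xs i \<le> w * x + z * y" and q: "- lo xs i \<le> z * x + w * y"
    and x: "w * x \<le> hi xs i" and y: "w * y \<le> - lo xs i"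
    and or: "z * x + w * y \<le> - lo xs i \<or> w * x + z * y \<le> hi xs i" by auto
  have pv: "(x + y) * cos b * tan a + (x - y) * sin b = w * x + z * y"
    and qv: "(x + y) * cos b * tan a - (x - y) * sin b = z * x + w * y"
    by (simp_all add: w z algebra_simps)
  have Csuc: "cost (Suc i) (hedge_pos a b xs) = x + y + dist (hedge_pos a b xs i) (hedge_pos a b xs (Suc i))"
    by (simp add: cost_def C[unfolded cost_def])
  consider "xs (Suc i) > hi xs i" | "xs (Suc i) < lo xs i" 
    using nonred[OF Suc_le_lessD[OF Suc.prems]] by (metis atLeastAtMost_iff not_le)
  then show ?case
  proof cases
    case 1
    let ?X = "xs (Suc i)"
    have lh: "lo xs (Suc i) = lo xs i" "hi xs (Suc i) = ?X" "?X > 0"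
      using 1 hi_nonneg[of xs i, OF xs] lo_nonpos[of xs i, OF xs] by (auto simp: lo_Suc hi_Suc)
    define t where "t = max 0 ((?X - (w * x + z * y)) / w)"
    have st: "hedge_pos a b xs (Suc i) = ((x - y) * sin b + t * 1 * sin b, (x + y) * cos b + t * cos b)"
         "dist (hedge_pos a b xs i) (hedge_pos a b xs (Suc i)) = t"
      using hedge_step[of a b 1 xs i "(x - y) * sin b" "(x + y) * cos b" ?X "- lo xs i" t]
        w z lh P FCs_iff[of a xs _ _ "Suc i", OF T xs] pv qv q
      by (simp_all add: t_def)
    have t0: "0 \<le> t" by (simp add: t_def)
    have wt: "w * t = max 0 (?X - (w * x + z * y))"
      using w by (auto simp: t_def max_def divide_simps)
    have nn: "0 \<le> z * t" "0 \<le> z * y" using t0 z xy by auto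
    show ?thesis
    proof (rule exI[of _ "x + t"], rule exI[of _ y], intro conjI)
      show "hedge_pos a b xs (Suc i) = ((x + t - y) * sin b, (x + t + y) * cos b)"
        by (simp add: st(1) algebra_simps)
      show "cost (Suc i) (hedge_pos a b xs) = x + t + y" by (simp add: Csuc st(2))
      \<comment> \<open>If the drone stays, either alternative is inherited, as the right extreme
        only grows. If it moves, its right end stops exactly at the request.\<close>
      show "z * (x + t) + w * y \<le> - lo xs (Suc i) \<or> w * (x + t) + z * y \<le> hi xs (Suc i)"
      proof (cases "t = 0")
        case True then show ?thesis using or 1 lh by auto
      next
        case False
        then have "w * t = ?X - (w * x + z * y)" using wt w by (auto simp: max_def split: if_splits)
        then show ?thesis using lh by (simp add: distrib_left)
      qed
    qed (use t0 xy p q x y 1 lh wt nn in \<open>auto simp: distrib_left\<close>)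
  next
    case 2
    let ?X = "xs (Suc i)"
    have lh: "lo xs (Suc i) = ?X" "hi xs (Suc i) = hi xs i" "?X < 0"
      using 2 hi_nonneg[of xs i, OF xs] lo_nonpos[of xs i, OF xs] by (auto simp: lo_Suc hi_Suc)
    define t where "t = max 0 ((- ?X - (z * x + w * y)) / w)"
    have st: "hedge_pos a b xs (Suc i) = ((x - y) * sin b + t * - 1 * sin b, (x + y) * cos b + t * cos b)"
         "dist (hedge_pos a b xs i) (hedge_pos a b xs (Suc i)) = t"
      \<comment> \<open>Mirror image: the left end is approached, so \<open>- ?X\<close> takes the
        role of \<open>X\<close> and \<open>hi xs i\<close> that of \<open>Y\<close>.\<close>
      using hedge_step[of a b "-1" xs i "(x - y) * sin b" "(x + y) * cos b" "- ?X" "hi xs i" t]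
        w z lh P FCs_iff[of a xs _ _ "Suc i", OF T xs] pv qv p
      by (simp_all add: t_def conj_commute)
    have t0: "0 \<le> t" by (simp add: t_def)
    have wt: "w * t = max 0 (- ?X - (z * x + w * y))"
      using w by (auto simp: t_def max_def divide_simps)
    have nn: "0 \<le> z * t" "0 \<le> z * x" using t0 z xy by auto
    show ?thesis
    proof (rule exI[of _ x], rule exI[of _ "y + t"], intro conjI)
      show "hedge_pos a b xs (Suc i) = ((x - (y + t)) * sin b, (x + (y + t)) * cos b)"
        by (simp add: st(1) algebra_simps)
      show "cost (Suc i) (hedge_pos a b xs) = x + (y + t)" by (simp add: Csuc st(2))
      show "z * x + w * (y + t) \<le> - lo xs (Suc i) \<or> w * x + z * (y + t) \<le> hi xs (Suc i)"
      proof (cases "t = 0")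
        case True then show ?thesis using or 2 lh by auto
      next
        case False
        then have "w * t = - ?X - (z * x + w * y)" using wt w by (auto simp: max_def split: if_splits)
        then show ?thesis using lh by (simp add: distrib_left)
      qed
    qed (use t0 xy p q x y 2 lh wt nn in \<open>auto simp: distrib_left\<close>)
  qed
qed

text \<open>The cost of the hedge on the two requests \<open>r\<close> and \<open>-1\<close>, in this order.\<close>

definition worst_cost :: "real \<Rightarrow> real \<Rightarrow> real \<Rightarrow> real" where
  "worst_cost a b r =
     (1 + 2 * sin b / (tan a * cos b + sin b) * r) / (tan a * cos b + sin b)"

section \<open>The largest cost of the hedge for a given extent\<close>

lemma hedge_speeds:
  assumes "0 < a" "a < pi / 2" "b \<in> {0..a}"
  shows "0 < tan a * cos b + sin b" and "0 \<le> tan a * cos b - sin b"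
    and "0 < tan a" and "0 \<le> sin b"
proof -
  show T: "0 < tan a" using assms by (simp add: tan_gt_zero)
  have c: "0 < cos b" using assms by (auto intro!: cos_gt_zero_pi)
  show s: "0 \<le> sin b" using assms by (auto intro!: sin_ge_zero)
  show "0 < tan a * cos b + sin b" using T c s by (simp add: add_pos_nonneg)
  have "tan b \<le> tan a" using assms by (intro tan_mono_le) auto
  then have "tan b * cos b \<le> tan a * cos b" using c by simp
  then show "0 \<le> tan a * cos b - sin b" using c by (simp add: tan_def)
qed

text \<open>A small linear program: maximise \<open>x + y\<close> subject to the upper bounds of the
  invariant. Its first alternative is tight for the request order \<open>r\<close>,
  \<open>-1\<close>.\<close>

lemma hedge_cost_le:
  assumes ab: "0 < a" "a < pi / 2" "b \<in> {0..a}" and good: "good_input n xs"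
  shows "hedge_cost a b n xs \<le> worst_cost a b (hi xs n)"
proof -
  define w where "w = tan a * cos b + sin b"
  define z where "z = tan a * cos b - sin b"
  note sp = hedge_speeds[OF ab]
  have w: "0 < w" and z: "0 \<le> z" "z \<le> w" using sp by (auto simp: w_def z_def)
  define r where "r = hi xs n"
  have r: "0 \<le> r" "r \<le> 1" and l: "lo xs n = -1" and x0: "xs 0 = 0"
    and nr: "\<And>i. i < n \<Longrightarrow> xs (Suc i) \<notin> {lo xs i..hi xs i}"
    using good by (auto simp: good_input_iff r_def)
  obtain x y where xy: "0 \<le> x" "0 \<le> y"
    and C: "cost n (hedge_pos a b xs) = x + y"
    and x: "w * x \<le> r" and y: "w * y \<le> 1"
    and or: "z * x + w * y \<le> 1 \<or> w * x + z * y \<le> r"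
    using hedge_invariant[of a w b z xs n n, OF sp(3) w w_def z(1) z_def x0 nr] unfolding l r_def by auto
  have "w * (w * (x + y)) \<le> w + (w - z) * r"
    using or
  proof
    assume "z * x + w * y \<le> 1"
    then have "w * (x + y) \<le> 1 + (w - z) * x" by (simp add: algebra_simps)
    then have "w * (w * (x + y)) \<le> w * (1 + (w - z) * x)" using w by simp
    also have "\<dots> = w + (w - z) * (w * x)" by (simp add: algebra_simps)
    also have "\<dots> \<le> w + (w - z) * r" using x z by (simp add: mult_left_mono)
    finally show ?thesis .
  next
    assume "w * x + z * y \<le> r"
    then have "w * (x + y) \<le> r + (w - z) * y" by (simp add: algebra_simps)
    then have "w * (w * (x + y)) \<le> w * (r + (w - z) * y)" using w by simp
    also have "\<dots> = w * r + (w - z) * (w * y)" by (simp add: algebra_simps)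
    also have "\<dots> \<le> w * r + (w - z) * 1" using y z by (intro add_left_mono mult_left_mono) auto
    \<comment> \<open>The second alternative belongs to the order \<open>-1\<close>,
      \<open>r\<close>; since \<open>r \<le> 1\<close>, its bound is no larger.\<close>
    also have "\<dots> = w + (w - z) * r - z * (1 - r)" by (simp add: algebra_simps)
    also have "\<dots> \<le> w + (w - z) * r" using z r by simp
    finally show ?thesis .
  qed
  then have "x + y \<le> (w + (w - z) * r) / (w * w)"
    using w by (simp add: pos_le_divide_eq algebra_simps)
  also have "\<dots> = (1 + (w - z) / w * r) / w" using w by (simp add: field_simps)
  also have "w - z = 2 * sin b" by (simp add: w_def z_def)
  finally show ?thesis by (simp add: hedge_cost_def C worst_cost_def r_def w_def)
qed

lemma worst_cost_attained:
  assumes ab: "0 < a" "a < pi / 2" "b \<in> {0..a}" and r: "r \<in> {0..1}"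
  obtains n xs where "good_input n xs" "hi xs n = r" "hedge_cost a b n xs = worst_cost a b r"
proof -
  define w where "w = tan a * cos b + sin b"
  define z where "z = tan a * cos b - sin b"
  note sp = hedge_speeds[OF ab]
  have w: "0 < w" and z: "0 \<le> z" "z \<le> w" using sp by (auto simp: w_def z_def)
  show ?thesis
  proof (cases "r = 0")
    case True
    \<comment> \<open>A request at 0 would be redundant, so \<open>-1\<close> is the only
      request.\<close>
    define xs :: "nat \<Rightarrow> real" where "xs = (\<lambda>i. if i = 0 then 0 else -1)"
    have x0: "xs 0 = 0" and h: "hi xs 1 = 0" and l: "lo xs 1 = -1"
      by (simp_all add: xs_def hi_Suc lo_Suc)
    have good: "good_input 1 xs" using h l by (auto simp: good_input_iff xs_def)
    then have nr: "\<And>i. i < 1 \<Longrightarrow> xs (Suc i) \<notin> {lo xs i..hi xs i}"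
      by (simp add: good_input_iff)
    obtain x y where xy: "0 \<le> x" "0 \<le> y" "cost 1 (hedge_pos a b xs) = x + y"
      "w * x \<le> 0" "1 \<le> z * x + w * y" "w * y \<le> 1"
      using hedge_invariant[of a w b z xs 1 1, OF sp(3) w w_def z(1) z_def x0 nr] unfolding h l by auto
    then have "x = 0" using w by (simp add: mult_le_0_iff)
    then have "x + y = 1 / w" using xy w by (simp add: field_simps)
    then show ?thesis using that[of 1 xs] good h True xy
      by (simp add: hedge_cost_def worst_cost_def w_def)
  next
    case False
    then have r0: "0 < r" "r \<le> 1" using r by auto
    define xs :: "nat \<Rightarrow> real" where "xs = (\<lambda>i. if i = 0 then 0 else if i = 1 then r else -1)"
    have x0: "xs 0 = 0" and h1: "hi xs 1 = r" and l1: "lo xs 1 = 0"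
      and h2: "hi xs 2 = r" and l2: "lo xs 2 = -1" and x2: "xs 2 = -1"
      using r0 by (simp_all add: xs_def hi_Suc lo_Suc numeral_2_eq_2)
    have nr: "xs (Suc i) \<notin> {lo xs i..hi xs i}" if i: "i < 2" for i
    proof -
      consider "i = 0" | "i = 1" using less_2_cases[OF i] by auto
      then show ?thesis
      proof cases
        case 1 then show ?thesis using r0 by (simp add: xs_def)
      next
        case 2 then show ?thesis using l1 x2 by (simp add: numeral_2_eq_2)
      qed
    qed
    have good: "good_input 2 xs" using h2 l2 x0 nr r0 by (simp add: good_input_iff)
    \<comment> \<open>After the first request the lower and upper bounds of the invariant meet and
      determine \<open>x\<close> and \<open>y\<close>.\<close>
    obtain x y where xy: "0 \<le> x" "0 \<le> y"
      and P: "hedge_pos a b xs 1 = ((x - y) * sin b, (x + y) * cos b)"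
      and C: "cost 1 (hedge_pos a b xs) = x + y"
      and *: "w * x \<le> r" "r \<le> w * x + z * y" "w * y \<le> 0"
      using hedge_invariant[of a w b z xs 2 1, OF sp(3) w w_def z(1) z_def x0 nr] unfolding h1 l1 by auto
    have y: "y = 0" using * w xy by (simp add: mult_le_0_iff)
    then have wx: "w * x = r" using * by simp
    then have x: "x = r / w" using w by (simp add: field_simps)
    have "z * r \<le> w * 1" using z r0 w by (intro mult_mono) auto
    then have zr: "z * r / w \<le> 1" using w by simp
    \<comment> \<open>The first move has already extended the left end by \<open>z * r / w\<close>;
      \<open>t\<close> makes up the rest at rate \<open>w\<close>.\<close>
    define t where "t = (1 - z * r / w) / w"
    have t0: "0 \<le> t" using zr w by (simp add: t_def)
    have q: "x * cos b * tan a - x * sin b = z * r / w" by (simp add: z_def x algebra_simps diff_divide_distrib)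
    have p: "x * cos b * tan a + x * sin b = r" using wx by (simp add: w_def algebra_simps)
    have "dist (hedge_pos a b xs 1) (hedge_pos a b xs (Suc 1)) = t"
    proof (rule hedge_step(2)[of a b "-1" xs 1 "x * sin b" "x * cos b" 1 r])
      show "sgn (xs (Suc 1)) = -1" using x2 by (simp add: numeral_2_eq_2)
      show "(u, v) \<in> FCs a xs (Suc 1) \<longleftrightarrow> 1 \<le> v * tan a + - 1 * u \<and> r \<le> v * tan a - - 1 * u" for u v
        using FCs_iff[of a xs u v 2, OF sp(3) x0] h2 l2 by (auto simp: numeral_2_eq_2)
      show "t = max 0 ((1 - (x * cos b * tan a + - 1 * (x * sin b))) / (tan a * cos b + sin b))"
        using t0 q by (simp add: w_def[symmetric] t_def)
    qed (use sp P y p in auto)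
    then have "cost 2 (hedge_pos a b xs) = r / w + t"
      using C x y by (simp add: cost_def numeral_2_eq_2)
    also have "\<dots> = (1 + (w - z) / w * r) / w" using w by (simp add: t_def field_simps)
    also have "w - z = 2 * sin b" by (simp add: w_def z_def)
    finally show ?thesis using that[of 2 xs] good h2
      by (simp add: hedge_cost_def worst_cost_def w_def)
  qed
qed

section \<open>The offline optimum\<close>

text \<open>The distance from the origin to the final feasibility cone: for small \<open>r\<close> the foot of the
  perpendicular on the left boundary ray is feasible, otherwise the apex is nearest.\<close>

definition opt_length :: "real \<Rightarrow> real \<Rightarrow> real" where
  "opt_length a r = (if r \<le> - cos (2 * a) then cos a
     else sqrt (1 + r\<^sup>2 + 2 * cos (2 * a) * r) / (2 * sin a))"

text \<open>Law of cosines: \<open>(u, v)\<close> is p times one vector plus q times another, both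
  of length \<open>1 / (2 * sin a)\<close> and at angle \<open>2 * a\<close> to each other.\<close>

lemma norm_cone_coordinates:
  fixes a u v :: real
  assumes "0 < a" "a < pi / 2"
  defines "p \<equiv> v * tan a + u" and "q \<equiv> v * tan a - u"
  shows "4 * (sin a)\<^sup>2 * (norm (u, v))\<^sup>2 = p\<^sup>2 + q\<^sup>2 + 2 * p * q * cos (2 * a)"
proof -
  have "cos a \<noteq> 0" using assms(1,2) by (metis cos_gt_zero less_irrefl)
  then have v: "v * tan a * cos a = v * sin a" by (simp add: tan_def)
  have "p\<^sup>2 + q\<^sup>2 + 2 * p * q * cos (2 * a)
      = 2 * (v * tan a)\<^sup>2 * (1 + cos (2 * a)) + 2 * u\<^sup>2 * (1 - cos (2 * a))"
    by (simp add: p_def q_def power2_eq_square algebra_simps)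
  also have "1 + cos (2 * a) = 2 * (cos a)\<^sup>2" by (simp add: cos_double_cos)
  also have "1 - cos (2 * a) = 2 * (sin a)\<^sup>2" by (simp add: cos_double_sin)
  also have "2 * (v * tan a)\<^sup>2 * (2 * (cos a)\<^sup>2) = 4 * (v * tan a * cos a)\<^sup>2"
    by (simp add: power_mult_distrib)
  also have "\<dots> = 4 * (v * sin a)\<^sup>2" by (simp add: v)
  finally show ?thesis by (simp add: norm_prod_def power_mult_distrib algebra_simps)
qed

lemma opt_length_le_norm:
  assumes a: "0 < a" "a < pi / 2" and r: "r \<in> {0..1}"
    and p: "r \<le> v * tan a + u" and q: "1 \<le> v * tan a - u"
  shows "opt_length a r \<le> norm (u, v)"
proof (cases "r \<le> - cos (2 * a)")
  case True
  have c: "0 < cos a" using a by (intro cos_gt_zero_pi) auto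
  have "cos a \<le> cos a * (v * tan a - u)" using q c by simp
  also have "\<dots> = v * sin a - u * cos a" using c by (simp add: tan_def algebra_simps)
  \<comment> \<open>The second vector is the unit normal of the boundary line
    \<open>v * tan a - u = 1\<close>.\<close>
  also have "\<dots> = inner (u, v) (- cos a, sin a)" by simp
  also have "\<dots> \<le> norm (u, v) * norm (- cos a, sin a)" by (rule norm_cauchy_schwarz)
  also have "norm (- cos a, sin a) = 1" by (simp add: norm_prod_def)
  finally show ?thesis using True by (simp add: opt_length_def)
next
  case False
  define c where "c = cos (2 * a)"
  define x y where "x = v * tan a + u - r" and "y = v * tan a - u - 1"
  have s: "0 < sin a" using a by (intro sin_gt_zero) auto
  have xy: "0 \<le> x" "0 \<le> y" using p q by (auto simp: x_def y_def)
  have c1: "-1 \<le> c" "c \<le> 1" by (simp_all add: c_def)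
  have rc: "0 \<le> r + c" using False by (simp add: c_def)
  have "r * (-1) \<le> r * c" using r c1 by (intro mult_left_mono) auto
  then have rc1: "0 \<le> 1 + r * c" using r by auto
  \<comment> \<open>The growth of the quadratic form from \<open>(r, 1)\<close> to
    \<open>(r + x, 1 + y)\<close>, split into nonnegative terms.\<close>
  have "0 \<le> (x - y)\<^sup>2 + 2 * (x * y) * (1 + c) + 2 * x * (r + c) + 2 * y * (1 + r * c)"
    using xy c1 rc rc1 by simp
  also have "\<dots> = (r + x)\<^sup>2 + (1 + y)\<^sup>2 + 2 * (r + x) * (1 + y) * c - (1 + r\<^sup>2 + 2 * c * r)"
    by (simp add: power2_eq_square algebra_simps)
  finally have "1 + r\<^sup>2 + 2 * c * r \<le> (r + x)\<^sup>2 + (1 + y)\<^sup>2 + 2 * (r + x) * (1 + y) * c" by simp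
  also have "\<dots> = 4 * (sin a)\<^sup>2 * (norm (u, v))\<^sup>2"
    using norm_cone_coordinates[OF a, of u v] by (simp add: x_def y_def c_def)
  also have "\<dots> = (norm (u, v) * (2 * sin a))\<^sup>2" by (simp add: power_mult_distrib)
  finally have "sqrt (1 + r\<^sup>2 + 2 * c * r) \<le> norm (u, v) * (2 * sin a)"
    using s by (simp add: real_le_lsqrt)
  then show ?thesis using False s by (simp add: opt_length_def c_def pos_divide_le_eq)
qed

lemma opt_length_attained:
  assumes a: "0 < a" "a < pi / 2" and r: "r \<in> {0..1}"
  obtains u v where "r \<le> v * tan a + u" "1 \<le> v * tan a - u" "norm (u, v) = opt_length a r"
proof (cases "r \<le> - cos (2 * a)")
  case True
  have c: "0 < cos a" using a by (intro cos_gt_zero_pi) auto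
  have t: "cos a * sin a * tan a = (sin a)\<^sup>2" using c by (simp add: tan_def power2_eq_square)
  \<comment> \<open>The foot of the perpendicular from the origin to the line
    \<open>v * tan a - u = 1\<close>. Its p-coordinate is \<open>- cos (2 * a)\<close>, which
    explains the case distinction.\<close>
  have "norm (- (cos a)\<^sup>2, cos a * sin a) = norm (cos a *\<^sub>R (- cos a, sin a))"
    by (simp add: power2_eq_square)
  also have "\<dots> = cos a * norm (- cos a, sin a)" using c by (simp only: norm_scaleR)
  also have "norm (- cos a, sin a) = 1" by (simp add: norm_prod_def)
  finally show ?thesis using True t
    by (intro that[of "cos a * sin a" "- (cos a)\<^sup>2"]) (auto simp: opt_length_def cos_double)
next
  case False
  have T: "0 < tan a" using a by (simp add: tan_gt_zero)
  have s: "0 < sin a" using a by (intro sin_gt_zero) auto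
  \<comment> \<open>The apex of the cone, where p equals \<open>r\<close> and q equals 1.\<close>
  define u v where "u = (r - 1) / 2" and "v = (r + 1) / (2 * tan a)"
  have p: "v * tan a + u = r" and q: "v * tan a - u = 1" using T by (simp_all add: u_def v_def field_simps)
  have "(2 * sin a * norm (u, v))\<^sup>2 = 1 + r\<^sup>2 + 2 * cos (2 * a) * r"
    using norm_cone_coordinates[OF a, of u v] p q by (simp add: power_mult_distrib)
  then have "2 * sin a * norm (u, v) = sqrt (1 + r\<^sup>2 + 2 * cos (2 * a) * r)"
    using s by (intro real_sqrt_unique[symmetric]) auto
  then show ?thesis using that[of v u] p q False s by (simp add: opt_length_def field_simps)
qed

text \<open>The cones shrink as requests arrive, so going at once to the nearest point of the final
  cone and waiting there is a solution. The triangle inequality shows that none is cheaper.\<close>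

lemma OPT_eq_opt_length:
  assumes a: "0 < a" "a < pi / 2" and good: "good_input n xs"
  shows "OPT a n xs = opt_length a (hi xs n)"
proof -
  define r where "r = hi xs n"
  have T: "0 < tan a" using a by (simp add: tan_gt_zero)
  have r: "r \<in> {0..1}" and l: "lo xs n = -1" and x0: "xs 0 = 0" and n: "n \<ge> 1"
    using good by (auto simp: good_input_iff r_def)
  obtain u v where uv: "r \<le> v * tan a + u" "1 \<le> v * tan a - u" "norm (u, v) = opt_length a r"
    by (rule opt_length_attained[OF a r])
  define P where "P = (\<lambda>i::nat. if i = 0 then (0, 0) else (u, v))"
  have "(u, v) \<in> FCs a xs n" using uv l by (simp add: FCs_iff[of a xs, OF T x0] r_def)
  then have "(u, v) \<in> FCs a xs i" if "i \<le> n" for i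
    using that by (auto simp: FCs_def)
  then have sol: "is_solution a n xs P"
    using x0 by (auto simp: is_solution_def P_def FCs_def FC_def)
  have "cost n P = (\<Sum>i<n. if i = 0 then norm (u, v) else 0)"
    unfolding cost_def by (intro sum.cong) (auto simp: P_def dist_norm norm_prod_def)
  then have cP: "cost n P = opt_length a r" using n uv by simp
  have lower: "opt_length a r \<le> cost n P" if "is_solution a n xs P" for P
  proof -
    obtain u v where Pn: "P n = (u, v)" by fastforce
    have "P n \<in> FCs a xs n" and P0: "P 0 = (0, 0)" using that by (auto simp: is_solution_def)
    then have "opt_length a r \<le> norm (P n)"
      using opt_length_le_norm[OF a r] l by (simp add: Pn FCs_iff[of a xs, OF T x0] r_def)
    also have "\<dots> = dist (P 0) (P n)" by (simp add: P0 zero_prod_def[symmetric])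
    also have "\<dots> \<le> cost n P"
    proof (induction n)
      case (Suc n)
      then show ?case using dist_triangle[of "P 0" "P (Suc n)" "P n"] by (simp add: cost_def)
    qed (simp add: cost_def)
    finally show ?thesis .
  qed
  show ?thesis unfolding OPT_def r_def[symmetric]
    using sol cP lower by (intro cInf_eq_minimum) force+
qed

lemma opt_length_pos:
  assumes a: "0 < a" "a < pi / 2" and r: "r \<in> {0..1}"
  shows "0 < opt_length a r"
proof -
  obtain u v where uv: "r \<le> v * tan a + u" "1 \<le> v * tan a - u" "norm (u, v) = opt_length a r"
    by (rule opt_length_attained[OF a r])
  then have "(u, v) \<noteq> 0" by (auto simp: zero_prod_def)
  then show ?thesis using uv by (metis zero_less_norm_iff)
qed

section \<open>The ratio for a given extent\<close>

definition worst_ratio :: "real \<Rightarrow> real \<Rightarrow> real \<Rightarrow> real" where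
  "worst_ratio a b r = worst_cost a b r / opt_length a r"

text \<open>For fixed \<open>r\<close> the optimum is constant, so the supremum only concerns the
  cost of the hedge, whose maximum is attained.\<close>

lemma hedge_ratio_at_eq:
  assumes ab: "0 < a" "a < pi / 2" "b \<in> {0..a}" and r: "r \<in> {0..1}"
  shows "hedge_ratio_at a b r = ereal (worst_ratio a b r)"
proof (rule antisym)
  show "hedge_ratio_at a b r \<le> ereal (worst_ratio a b r)"
    unfolding hedge_ratio_at_def hi_def[symmetric]
    using hedge_cost_le[OF ab] OPT_eq_opt_length[OF ab(1,2)] opt_length_pos[OF ab(1,2) r]
    by (intro SUP_least) (auto simp: worst_ratio_def intro!: divide_right_mono)
  obtain n xs where "good_input n xs" "hi xs n = r" "hedge_cost a b n xs = worst_cost a b r"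
    by (rule worst_cost_attained[OF ab r])
  then show "ereal (worst_ratio a b r) \<le> hedge_ratio_at a b r"
    unfolding hedge_ratio_at_def hi_def[symmetric]
    by (intro SUP_upper2[of "(n, xs)"]) (auto simp: worst_ratio_def OPT_eq_opt_length[OF ab(1,2)])
qed

lemma hedge_ratio_eq_SUP: "hedge_ratio a b = (SUP r\<in>{0..1}. hedge_ratio_at a b r)"
proof (rule antisym)
  show "hedge_ratio a b \<le> (SUP r\<in>{0..1}. hedge_ratio_at a b r)"
    unfolding hedge_ratio_def
  proof (rule SUP_least)
    fix p :: "nat \<times> (nat \<Rightarrow> real)" assume p: "p \<in> {(n, xs). good_input n xs}"
    then show "ereal (hedge_cost a b (fst p) (snd p) / OPT a (fst p) (snd p))
        \<le> (SUP r\<in>{0..1}. hedge_ratio_at a b r)"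
      unfolding hedge_ratio_at_def hi_def[symmetric]
      by (intro SUP_upper2[of "hi (snd p) (fst p)"] SUP_upper) (auto simp: good_input_iff)
  qed
  show "(SUP r\<in>{0..1}. hedge_ratio_at a b r) \<le> hedge_ratio a b"
    unfolding hedge_ratio_def hedge_ratio_at_def by (intro SUP_least SUP_upper) auto
qed

section \<open>Optimising the extent and the angle\<close>

text \<open>With \<open>T = tan a\<close> and \<open>t = tan b\<close>, this is the squared maximum of \<open>f1 a b\<close> over all real \<open>r\<close>.\<close>

definition peak_sq :: "real \<Rightarrow> real \<Rightarrow> real" where
  "peak_sq T t = (1 + t\<^sup>2) * ((T - t)\<^sup>2 + T\<^sup>2 * (T + 3 * t)\<^sup>2) / (T + t) ^ 4"

lemma peak_sq_has_derivative:
  assumes "0 < T + t"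
  shows "((\<lambda>t. peak_sq T t) has_real_derivative
     2 * ((1 + 5 * T\<^sup>2) * t - T * (3 - T\<^sup>2)) * (3 * T * t\<^sup>2 + (T\<^sup>2 - 1) * t + T) / (T + t) ^ 5) (at t)"
proof -
  define R where "R = (T - t)\<^sup>2 + T\<^sup>2 * (T + 3 * t)\<^sup>2"
  define R' where "R' = - 2 * (T - t) + 6 * T\<^sup>2 * (T + 3 * t)"
  have "((\<lambda>t. peak_sq T t) has_real_derivative
      ((2 * t * R + (1 + t\<^sup>2) * R') * (T + t) ^ 4 - (1 + t\<^sup>2) * R * (4 * (T + t) ^ 3)) / ((T + t) ^ 4 * (T + t) ^ 4)) (at t)"
    unfolding peak_sq_def R_def R'_def using assms
    by (auto intro!: derivative_eq_intros simp: algebra_simps)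
  \<comment> \<open>A factor \<open>(T + t) ^ 3\<close> of the numerator cancels against the eighth
    power below.\<close>
  moreover have "((2 * t * R + (1 + t\<^sup>2) * R') * (T + t) ^ 4 - (1 + t\<^sup>2) * R * (4 * (T + t) ^ 3))
      = ((2 * t * R + (1 + t\<^sup>2) * R') * (T + t) - 4 * (1 + t\<^sup>2) * R) * (T + t) ^ 3"
    by (simp add: algebra_simps power_numeral_reduce)
  moreover have "(2 * t * R + (1 + t\<^sup>2) * R') * (T + t) - 4 * (1 + t\<^sup>2) * R
      = 2 * ((1 + 5 * T\<^sup>2) * t - T * (3 - T\<^sup>2)) * (3 * T * t\<^sup>2 + (T\<^sup>2 - 1) * t + T)"
    unfolding R_def R'_def by (simp add: algebra_simps power_numeral_reduce)
  moreover have "x * (T + t) ^ 3 / ((T + t) ^ 4 * (T + t) ^ 4) = x / (T + t) ^ 5" for x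
  proof -
    have eq: "(T + t) ^ 4 * (T + t) ^ 4 = (T + t) ^ 5 * (T + t) ^ 3" by (simp flip: power_add)
    show ?thesis unfolding eq using assms by (subst mult_divide_mult_cancel_right) auto
  qed
  ultimately show ?thesis by simp
qed

lemma peak_sq_minimum:
  assumes T: "0 < T" and t: "t \<in> {0..T}"
  shows "peak_sq T (max 0 (min T (T * (3 - T\<^sup>2) / (1 + 5 * T\<^sup>2)))) \<le> peak_sq T t"
proof -
  define m where "m = T * (3 - T\<^sup>2) / (1 + 5 * T\<^sup>2)"
  define t0 where "t0 = max 0 (min T m)"
  have t0: "0 \<le> t0" "t0 \<le> T" using T by (auto simp: t0_def)
  have D: "0 < 1 + 5 * T\<^sup>2" by (simp add: add_pos_nonneg)
  \<comment> \<open>On \<open>[0, T]\<close> the last summand \<open>T\<close> outweighs the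
    negative term \<open>- s\<close>, so only the linear factor decides the sign of the
    derivative.\<close>
  have quad: "0 \<le> 3 * T * s\<^sup>2 + (T\<^sup>2 - 1) * s + T" if "0 \<le> s" "s \<le> T" for s
  proof -
    have "3 * T * s\<^sup>2 + (T\<^sup>2 - 1) * s + T = 3 * T * s\<^sup>2 + T\<^sup>2 * s + (T - s)" by (simp add: algebra_simps)
    also have "0 \<le> \<dots>" using that T by simp
    finally show ?thesis by simp
  qed
  define D' where "D' = (\<lambda>s. 2 * ((1 + 5 * T\<^sup>2) * s - T * (3 - T\<^sup>2))
    * (3 * T * s\<^sup>2 + (T\<^sup>2 - 1) * s + T) / (T + s) ^ 5)"
  have der: "(peak_sq T has_real_derivative D' s) (at s)" if "0 \<le> s" for s
    unfolding D'_def using T that by (intro peak_sq_has_derivative) simp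
  have "peak_sq T t0 \<le> peak_sq T t"
  proof (cases t t0 rule: linorder_cases)
    case less
    show ?thesis
    proof (rule DERIV_nonpos_imp_nonincreasing[of t t0])
      fix s assume s: "t \<le> s" "s \<le> t0"
      \<comment> \<open>From \<open>0 \<le> t < t0\<close> the lower clamp is inactive, so
        \<open>t0 \<le> m\<close>; in the other case \<open>t0 < T\<close> gives
        \<open>m \<le> t0\<close>.\<close>
      have "s \<le> m" using less s t unfolding t0_def by auto
      then have "(1 + 5 * T\<^sup>2) * s - T * (3 - T\<^sup>2) \<le> 0"
        using D by (simp add: m_def pos_le_divide_eq algebra_simps)
      moreover have "0 < T + s" "s \<le> T" and "0 \<le> s" using T t t0 s by auto
      ultimately have "D' s \<le> 0" unfolding D'_def using quad[of s]
        by (intro divide_nonpos_nonneg mult_nonpos_nonneg[of "2 * _"]) auto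
      then show "\<exists>y. (peak_sq T has_real_derivative y) (at s) \<and> y \<le> 0"
        using der[of s] \<open>0 \<le> s\<close> by blast
    qed (use less in auto)
  next
    case greater
    show ?thesis
    proof (rule DERIV_nonneg_imp_nondecreasing[of t0 t])
      fix s assume s: "t0 \<le> s" "s \<le> t"
      have "m \<le> s" using s t greater unfolding t0_def by auto
      then have "0 \<le> (1 + 5 * T\<^sup>2) * s - T * (3 - T\<^sup>2)"
        using D by (simp add: m_def pos_divide_le_eq algebra_simps)
      moreover have "0 < T + s" "s \<le> T" and "0 \<le> s" using T t t0 s by auto
      ultimately have "0 \<le> D' s" unfolding D'_def using quad[of s]
        by (intro divide_nonneg_nonneg mult_nonneg_nonneg) auto
      then show "\<exists>y. (peak_sq T has_real_derivative y) (at s) \<and> 0 \<le> y"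
        using der[of s] \<open>0 \<le> s\<close> by blast
    qed (use greater in auto)
  qed simp
  then show ?thesis by (simp add: t0_def m_def)
qed

section \<open>The largest ratio over all extents for a fixed angle\<close>

lemma cone_angle_facts:
  assumes "0 < a" "a < pi / 2" "b \<in> {0..a}"
  shows "0 < sin a" "0 < cos a" "0 < cos b" "0 < tan a" "0 \<le> tan b" "tan b \<le> tan a"
    and "cos (2 * a) = (1 - (tan a)\<^sup>2) / (1 + (tan a)\<^sup>2)"
    and "(cos b)\<^sup>2 * (1 + (tan b)\<^sup>2) = 1" "(cos a)\<^sup>2 * (1 + (tan a)\<^sup>2) = 1"
    and "-1 < cos (2 * a)" "cos (2 * a) < 1"
    and "sin a = cos a * tan a"
proof -
  show s: "0 < sin a" using assms by (intro sin_gt_zero) auto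
  show c: "0 < cos a" using assms by (intro cos_gt_zero_pi) auto
  show c': "0 < cos b" using assms by (intro cos_gt_zero_pi) auto
  show "0 < tan a" using assms by (simp add: tan_gt_zero)
  show "0 \<le> tan b" using assms c' by (auto simp: tan_def intro!: sin_ge_zero divide_nonneg_nonneg)
  show "tan b \<le> tan a" using assms by (intro tan_mono_le) auto
  show "cos (2 * a) = (1 - (tan a)\<^sup>2) / (1 + (tan a)\<^sup>2)" using c by (simp add: cos_tan_half)
  show "(cos b)\<^sup>2 * (1 + (tan b)\<^sup>2) = 1" "(cos a)\<^sup>2 * (1 + (tan a)\<^sup>2) = 1"
    using c c' by (auto simp: tan_def field_simps)
  show "-1 < cos (2 * a)" using c by (simp add: cos_double_cos)
  show "cos (2 * a) < 1" using s by (simp add: cos_double_sin)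
  show "sin a = cos a * tan a" using c by (simp add: tan_def)
qed

lemma power2_mult_divide_power4:
  fixes x y :: real
  assumes "x \<noteq> 0"
  shows "x\<^sup>2 * y / x ^ 4 = y / x\<^sup>2"
proof -
  have eq: "x ^ 4 = x\<^sup>2 * x\<^sup>2" by (simp flip: power_add)
  show ?thesis unfolding eq using assms by (subst mult_divide_mult_cancel_left) auto
qed

lemma apex_norm_pos:
  fixes c r :: real
  assumes "-1 < c" "c < 1"
  shows "0 < 1 + r\<^sup>2 + 2 * c * r"
proof -
  have "c\<^sup>2 < 1" using assms by (simp add: abs_square_less_1)
  moreover have "1 + r\<^sup>2 + 2 * c * r = (r + c)\<^sup>2 + (1 - c\<^sup>2)"
    by (simp add: power2_eq_square algebra_simps)
  ultimately show ?thesis by (smt (verit) zero_le_power2)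
qed

text \<open>\<open>f1\<close> presumes an optimum at the apex. At the switch point
  \<open>r = - cos (2 * a)\<close> both branches of \<open>opt_length\<close> agree, so equality is
  allowed.\<close>

lemma worst_ratio_eq_f1:
  assumes ab: "0 < a" "a < pi / 2" "b \<in> {0..a}" and r: "- cos (2 * a) \<le> r"
  shows "worst_ratio a b r = f1 a b r"
proof -
  note F = cone_angle_facts[OF ab]
  have "opt_length a r = sqrt (1 + r\<^sup>2 + 2 * cos (2 * a) * r) / (2 * sin a)"
  proof (cases "r = - cos (2 * a)")
    case True
    have "1 + r\<^sup>2 + 2 * cos (2 * a) * r = (sin (2 * a))\<^sup>2"
      by (simp add: True sin_squared_eq) (simp add: power2_eq_square)
    also have "sqrt \<dots> = 2 * sin a * cos a" using F(1,2) by (simp add: sin_double)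
    finally show ?thesis using True F(1) by (simp add: opt_length_def)
  qed (use r in \<open>simp add: opt_length_def\<close>)
  moreover have "cos b * (tan a + tan b) = tan a * cos b + sin b"
    using F(3) by (simp add: tan_def algebra_simps)
  moreover have "2 * sin b / (tan a * cos b + sin b) = 2 * tan b / (tan a + tan b)"
  proof -
    have "2 * sin b / (tan a * cos b + sin b) = (cos b * (2 * tan b)) / (cos b * (tan a + tan b))"
      using F(3) by (simp add: tan_def algebra_simps)
    also have "\<dots> = 2 * tan b / (tan a + tan b)" using F(3) by (subst mult_divide_mult_cancel_left) auto
    finally show ?thesis .
  qed
  ultimately show ?thesis by (simp add: worst_ratio_def worst_cost_def f1_def)
qed

lemma f1_nonneg:
  assumes ab: "0 < a" "a < pi / 2" "b \<in> {0..a}" and r: "-1 \<le> r"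
  shows "0 \<le> f1 a b r"
proof -
  note F = cone_angle_facts[OF ab]
  define A where "A = 2 * tan b / (tan a + tan b)"
  have A: "0 \<le> A" "A \<le> 1" using F(4-6) by (auto simp: A_def field_simps)
  have "A * (-1) \<le> A * r" using A r by (intro mult_left_mono) auto
  then have "0 \<le> 1 + A * r" using A by simp
  then show ?thesis
    using F(1,3,4,5) apex_norm_pos[OF F(10,11), of r]
    by (simp add: f1_def A_def[symmetric] del: times_divide_eq_left times_divide_eq_right)
qed

text \<open>Cauchy--Schwarz for the form \<open>x\<^sup>2 + 2 c x y + y\<^sup>2\<close>, kept as an identity because its
  remainder also locates the equality case \<open>r = r0 a b\<close>.\<close>

lemma f1_sq_deficit:
  assumes ab: "0 < a" "a < pi / 2" "b \<in> {0..a}"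
  defines "A \<equiv> 2 * tan b / (tan a + tan b)" and "c \<equiv> cos (2 * a)"
  shows "peak_sq (tan a) (tan b) - (f1 a b r)\<^sup>2 =
    (A - c - (1 - A * c) * r)\<^sup>2 / ((cos b * (tan a + tan b) * cos a)\<^sup>2 * (1 + r\<^sup>2 + 2 * c * r))"
proof -
  note F = cone_angle_facts[OF ab]
  define T t where "T = tan a" and "t = tan b"
  define N where "N = 1 + r\<^sup>2 + 2 * c * r"
  define K where "K = (cos b * (T + t) * cos a)\<^sup>2"
  have N: "0 < N" using apex_norm_pos[OF F(10,11)] by (simp add: N_def c_def)
  have Tt: "0 < T + t" "0 < T" using F(4,5) by (auto simp: T_def t_def)
  have D: "0 < 1 + T\<^sup>2" "0 < 1 + t\<^sup>2" by (simp_all add: add_pos_nonneg)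
  have cT: "c = (1 - T\<^sup>2) / (1 + T\<^sup>2)" using F(7) by (simp add: c_def T_def)
  have K: "K = (T + t)\<^sup>2 / ((1 + T\<^sup>2) * (1 + t\<^sup>2))"
  proof -
    have "(cos a)\<^sup>2 = 1 / (1 + T\<^sup>2)" "(cos b)\<^sup>2 = 1 / (1 + t\<^sup>2)"
      using F(8,9) D by (simp_all add: eq_divide_eq T_def t_def)
    then show ?thesis by (simp add: K_def power_mult_distrib)
  qed
  have c2: "(2 * sin a * cos a)\<^sup>2 = 1 - c\<^sup>2"
    using sin_squared_eq[of "2 * a"] by (simp add: sin_double c_def)
  have f: "(f1 a b r)\<^sup>2 = (1 - c\<^sup>2) * (1 + A * r)\<^sup>2 / (K * N)"
  proof -
    have "f1 a b r = 2 * sin a / (cos b * (T + t)) * ((1 + A * r) / sqrt N)"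
      by (simp add: f1_def A_def T_def t_def N_def c_def)
    \<comment> \<open>Expanding by \<open>cos a\<close> turns the numerator into
      \<open>sin (2 * a)\<close>, whose square is the determinant \<open>1 - c\<^sup>2\<close> of
      the form.\<close>
    also have "2 * sin a / (cos b * (T + t)) = 2 * sin a * cos a / (cos b * (T + t) * cos a)"
      using F(2) by simp
    finally have "(f1 a b r)\<^sup>2 = (2 * sin a * cos a)\<^sup>2 / K * ((1 + A * r)\<^sup>2 / (sqrt N)\<^sup>2)"
      by (simp only: K_def power_mult_distrib power_divide)
    then show ?thesis using N by (simp add: c2)
  qed
  have "(1 + T\<^sup>2) * (T + t)\<^sup>2 * (1 + A\<^sup>2 - 2 * A * c) = (T - t)\<^sup>2 + T\<^sup>2 * (T + 3 * t)\<^sup>2"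
  proof -
    have At: "A * (T + t) = 2 * t" using Tt by (simp add: A_def T_def t_def)
    have cD: "c * (1 + T\<^sup>2) = 1 - T\<^sup>2" using D by (simp add: cT)
    have "(1 + T\<^sup>2) * (T + t)\<^sup>2 * (1 + A\<^sup>2 - 2 * A * c)
        = (1 + T\<^sup>2) * ((T + t)\<^sup>2 + (A * (T + t))\<^sup>2) - 2 * (A * (T + t)) * (T + t) * (c * (1 + T\<^sup>2))"
      by (simp add: power2_eq_square algebra_simps)
    also have "\<dots> = (T - t)\<^sup>2 + T\<^sup>2 * (T + 3 * t)\<^sup>2"
      unfolding At cD by (simp add: power2_eq_square algebra_simps)
    finally show ?thesis .
  qed
  then have "peak_sq T t = (1 + t\<^sup>2) * ((1 + T\<^sup>2) * (T + t)\<^sup>2 * (1 + A\<^sup>2 - 2 * A * c)) / (T + t) ^ 4"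
    by (simp add: peak_sq_def)
  also have "\<dots> = (1 + A\<^sup>2 - 2 * A * c) / K"
    using power2_mult_divide_power4[of "T + t" "(1 + t\<^sup>2) * ((1 + T\<^sup>2) * (1 + A\<^sup>2 - 2 * A * c))"] Tt
    by (simp add: K mult_ac)
  finally have "peak_sq T t - (f1 a b r)\<^sup>2
      = ((1 + A\<^sup>2 - 2 * A * c) * N - (1 - c\<^sup>2) * (1 + A * r)\<^sup>2) / (K * N)"
    using N by (simp add: f diff_divide_distrib)
  also have "(1 + A\<^sup>2 - 2 * A * c) * N - (1 - c\<^sup>2) * (1 + A * r)\<^sup>2 = (A - c - (1 - A * c) * r)\<^sup>2"
    by (simp add: N_def power2_eq_square algebra_simps)
  finally show ?thesis by (simp add: K_def N_def T_def t_def)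
qed

lemma f1_le_peak:
  assumes ab: "0 < a" "a < pi / 2" "b \<in> {0..a}"
  shows "f1 a b r \<le> sqrt (peak_sq (tan a) (tan b))"
proof -
  note F = cone_angle_facts[OF ab]
  have "0 \<le> peak_sq (tan a) (tan b) - (f1 a b r)\<^sup>2"
    using apex_norm_pos[OF F(10,11), of r] by (simp add: f1_sq_deficit[OF ab])
  then show ?thesis by (simp add: real_le_rsqrt)
qed

lemma worst_ratio_le_peak:
  assumes ab: "0 < a" "a < pi / 2" "b \<in> {0..a}" and r: "r \<in> {0..1}"
  shows "worst_ratio a b r \<le> sqrt (peak_sq (tan a) (tan b))"
proof (cases "- cos (2 * a) \<le> r")
  case True
  then show ?thesis using f1_le_peak[OF ab] worst_ratio_eq_f1[OF ab] by simp
next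
  case False
  note F = cone_angle_facts[OF ab] and sp = hedge_speeds[OF ab]
  \<comment> \<open>Below the switch point the optimum is constant while the cost of the hedge grows
    with \<open>r\<close>.\<close>
  have "worst_cost a b r \<le> worst_cost a b (- cos (2 * a))"
    using False sp unfolding worst_cost_def
    by (intro divide_right_mono add_left_mono mult_left_mono) auto
  then have "worst_ratio a b r \<le> worst_ratio a b (- cos (2 * a))"
    using False F(2) by (simp add: worst_ratio_def opt_length_def divide_right_mono)
  also have "\<dots> \<le> sqrt (peak_sq (tan a) (tan b))"
    using f1_le_peak[OF ab] worst_ratio_eq_f1[OF ab] by simp
  finally show ?thesis .
qed

lemma r0_eq: "r0 a b = (2 * tan b / (tan a + tan b) - cos (2 * a)) / (1 - 2 * tan b / (tan a + tan b) * cos (2 * a))"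
proof -
  have "(2 * A - 2 * c) / (2 - A * (2 * c)) = (A - c) / (1 - A * c)" for A c :: real
    using mult_divide_mult_cancel_left[of 2 "A - c" "1 - A * c"] by (simp add: algebra_simps)
  then show ?thesis by (simp only: r0_def Let_def)
qed

text \<open>\<open>r0\<close> is the zero of the linear remainder in \<open>f1_sq_deficit\<close>,
  hence the maximiser. With \<open>A\<close> and \<open>c\<close> as below, \<open>r0 + c\<close>
  and \<open>1 - r0\<close> are \<open>A * (1 - c\<^sup>2)\<close> and
  \<open>(1 - A) * (1 + c)\<close> over the positive \<open>1 - A * c\<close>.\<close>

lemma r0_bounds:
  assumes ab: "0 < a" "a < pi / 2" "b \<in> {0..a}"
  shows "- cos (2 * a) \<le> r0 a b" "r0 a b \<le> 1"
    and "0 \<le> r0 a b \<longleftrightarrow> tan a * (1 - (tan a)\<^sup>2) \<le> tan b * (1 + 3 * (tan a)\<^sup>2)"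
    and "f1 a b (r0 a b) = sqrt (peak_sq (tan a) (tan b))"
proof -
  note F = cone_angle_facts[OF ab]
  define A c where "A = 2 * tan b / (tan a + tan b)" and "c = cos (2 * a)"
  have r0: "r0 a b = (A - c) / (1 - A * c)" by (simp add: r0_eq A_def c_def)
  have A: "0 \<le> A" "A \<le> 1" using F(4-6) by (auto simp: A_def field_simps)
  have c: "-1 < c" "c < 1" using F(10,11) by (auto simp: c_def)
  have Ac: "0 < 1 - A * c"
  proof (cases "0 \<le> c")
    case True
    then have "A * c \<le> 1 * c" using A by (intro mult_right_mono) auto
    then show ?thesis using c by simp
  next
    case False
    then have "A * c \<le> 0" using A by (simp add: mult_nonneg_nonpos)
    then show ?thesis by simp
  qed
  have "c\<^sup>2 \<le> 1" using c by (simp add: abs_square_le_1)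
  then have "0 \<le> A * (1 - c\<^sup>2)" using A by simp
  then show r1: "- cos (2 * a) \<le> r0 a b" unfolding r0 c_def[symmetric]
    using Ac by (simp add: pos_le_divide_eq power2_eq_square algebra_simps)
  have "0 \<le> (1 - A) * (1 + c)" using A c by simp
  then show "r0 a b \<le> 1" unfolding r0 using Ac by (simp add: pos_divide_le_eq algebra_simps)
  have "A - c - (1 - A * c) * r0 a b = 0" using Ac by (simp add: r0)
  then have "peak_sq (tan a) (tan b) - (f1 a b (r0 a b))\<^sup>2 = 0"
    using f1_sq_deficit[OF ab, of "r0 a b"] by (simp add: A_def c_def)
  then show "f1 a b (r0 a b) = sqrt (peak_sq (tan a) (tan b))"
    using f1_nonneg[OF ab, of "r0 a b"] r1 c by (simp add: c_def)
  have D: "0 < 1 + (tan a)\<^sup>2" by (simp add: add_pos_nonneg)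
  have "0 \<le> r0 a b \<longleftrightarrow> c \<le> A" unfolding r0 using Ac by (simp add: zero_le_divide_iff)
  also have "\<dots> \<longleftrightarrow> (1 - (tan a)\<^sup>2) * (tan a + tan b) \<le> 2 * tan b * (1 + (tan a)\<^sup>2)"
    unfolding A_def c_def F(7) using D F(4,5) by (subst pos_le_divide_eq) (simp_all add: pos_divide_le_eq)
  also have "\<dots> \<longleftrightarrow> tan a * (1 - (tan a)\<^sup>2) \<le> tan b * (1 + 3 * (tan a)\<^sup>2)"
    by (simp add: algebra_simps)
  finally show "0 \<le> r0 a b \<longleftrightarrow> tan a * (1 - (tan a)\<^sup>2) \<le> tan b * (1 + 3 * (tan a)\<^sup>2)" .
qed

section \<open>Bounding the ratio from below for every angle\<close>

lemma hedge_ratio_ge_worst_ratio: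
  assumes ab: "0 < a" "a < pi / 2" "b \<in> {0..a}" and r: "r \<in> {0..1}"
  shows "ereal (worst_ratio a b r) \<le> hedge_ratio a b"
  unfolding hedge_ratio_eq_SUP using r by (intro SUP_upper2[OF r]) (simp add: hedge_ratio_at_eq[OF ab r])

lemma hedge_ratio_eq_peak:
  assumes ab: "0 < a" "a < pi / 2" "b \<in> {0..a}" and r: "0 \<le> r0 a b"
  shows "hedge_ratio a b = ereal (sqrt (peak_sq (tan a) (tan b)))"
    and "hedge_ratio_at a b (r0 a b) = ereal (sqrt (peak_sq (tan a) (tan b)))"
proof -
  have r01: "r0 a b \<in> {0..1}" using r0_bounds(2)[OF ab] r by simp
  have w: "worst_ratio a b (r0 a b) = sqrt (peak_sq (tan a) (tan b))"
    using worst_ratio_eq_f1[OF ab] r0_bounds(1,4)[OF ab] by simp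
  then show "hedge_ratio_at a b (r0 a b) = ereal (sqrt (peak_sq (tan a) (tan b)))"
    by (simp add: hedge_ratio_at_eq[OF ab r01])
  show "hedge_ratio a b = ereal (sqrt (peak_sq (tan a) (tan b)))"
  proof (rule antisym)
    show "hedge_ratio a b \<le> ereal (sqrt (peak_sq (tan a) (tan b)))"
      unfolding hedge_ratio_eq_SUP
      by (intro SUP_least) (simp add: hedge_ratio_at_eq[OF ab] worst_ratio_le_peak[OF ab])
    show "ereal (sqrt (peak_sq (tan a) (tan b))) \<le> hedge_ratio a b"
      using hedge_ratio_ge_worst_ratio[OF ab r01] w by simp
  qed
qed

text \<open>For small \<open>b\<close> the critical extent \<open>r0\<close> is negative and the adversary does best
  with \<open>r = 0\<close>; the resulting ratio decreases in \<open>b\<close> until \<open>r0\<close> vanishes, at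
  \<open>tan b = s\<close> below.\<close>

lemma peak_le_f1_zero:
  assumes ab: "0 < a" "a < pi / 2" "b \<in> {0..a}" and r: "r0 a b < 0"
  defines "s \<equiv> tan a * (1 - (tan a)\<^sup>2) / (1 + 3 * (tan a)\<^sup>2)"
  shows "s \<in> {0..tan a}" and "sqrt (peak_sq (tan a) s) \<le> f1 a b 0"
proof -
  note F = cone_angle_facts[OF ab]
  define T t where "T = tan a" and "t = tan b"
  have T: "0 < T" and t: "0 \<le> t" using F(4,5) by (auto simp: T_def t_def)
  have D: "0 < 1 + T\<^sup>2" "0 < 1 + t\<^sup>2" "0 < 1 + 3 * T\<^sup>2" by (simp_all add: add_pos_nonneg)
  have "t * (1 + 3 * T\<^sup>2) < T * (1 - T\<^sup>2)" using r0_bounds(3)[OF ab] r by (simp add: T_def t_def)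
  then have ts: "t < s" using D by (simp add: s_def T_def[symmetric] pos_less_divide_eq)
  then have "0 < s" using t by simp
  \<comment> \<open>A positive \<open>s\<close> forces \<open>tan a < 1\<close>.\<close>
  then have T1: "T\<^sup>2 < 1" using D T by (simp add: s_def T_def[symmetric] zero_less_divide_iff zero_less_mult_iff)
  have sT: "s \<le> T" using D T unfolding s_def T_def[symmetric]
    by (simp add: pos_divide_le_eq algebra_simps)
  then show "s \<in> {0..tan a}" using \<open>0 < s\<close> by (simp add: T_def)
  have Ts: "T + s = 2 * T * (1 + T\<^sup>2) / (1 + 3 * T\<^sup>2)"
    and Tms: "T - s = 4 * T * T\<^sup>2 / (1 + 3 * T\<^sup>2)"
    and T3s: "T + 3 * s = 4 * T / (1 + 3 * T\<^sup>2)"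
    using D unfolding s_def T_def[symmetric] by (simp_all add: field_simps)
  \<comment> \<open>At \<open>tan b = s\<close> the critical extent is 0, so the peak reduces to the
    value of \<open>f1\<close> at extent 0.\<close>
  have "(1 + T\<^sup>2) * ((T - s)\<^sup>2 + T\<^sup>2 * (T + 3 * s)\<^sup>2) = 4 * T\<^sup>2 * (T + s)\<^sup>2"
  proof -
    have "(1 + T\<^sup>2) * ((4 * T * T\<^sup>2)\<^sup>2 + T\<^sup>2 * (4 * T)\<^sup>2) = 4 * T\<^sup>2 * (2 * T * (1 + T\<^sup>2))\<^sup>2"
      by (simp add: power2_eq_square algebra_simps)
    then show ?thesis unfolding Ts Tms T3s power_divide by (simp add: add_divide_distrib[symmetric])
  qed
  then have "(T - s)\<^sup>2 + T\<^sup>2 * (T + 3 * s)\<^sup>2 = 4 * T\<^sup>2 * (T + s)\<^sup>2 / (1 + T\<^sup>2)"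
    using D by (simp add: field_simps)
  then have "peak_sq T s = (1 + s\<^sup>2) * (4 * T\<^sup>2 * (T + s)\<^sup>2 / (1 + T\<^sup>2)) / (T + s) ^ 4"
    by (simp add: peak_sq_def)
  also have "\<dots> = 4 * T\<^sup>2 / (1 + T\<^sup>2) * ((1 + s\<^sup>2) / (T + s)\<^sup>2)"
    using power2_mult_divide_power4[of "T + s" "(1 + s\<^sup>2) * (4 * T\<^sup>2 / (1 + T\<^sup>2))"] T \<open>0 < s\<close>
    by (simp add: mult_ac)
  also have "\<dots> \<le> 4 * T\<^sup>2 / (1 + T\<^sup>2) * ((1 + t\<^sup>2) / (T + t)\<^sup>2)"
  proof (rule mult_left_mono)
    have "t * s \<le> T * T" using ts sT t T by (intro mult_mono) auto
    then have "t * s \<le> 1" using T1 by (simp add: power2_eq_square)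
    \<comment> \<open>This factorisation shows that \<open>(1 + t\<^sup>2) / (T + t)\<^sup>2\<close>
      is larger at \<open>t\<close> than at \<open>s\<close>.\<close>
    then have "0 \<le> (s - t) * ((1 - T\<^sup>2) * (s + t) + 2 * T * (1 - t * s))"
      using ts T1 t T \<open>0 < s\<close> by simp
    also have "\<dots> = (1 + t\<^sup>2) * (T + s)\<^sup>2 - (1 + s\<^sup>2) * (T + t)\<^sup>2"
      by (simp add: power2_eq_square algebra_simps)
    finally show "(1 + s\<^sup>2) / (T + s)\<^sup>2 \<le> (1 + t\<^sup>2) / (T + t)\<^sup>2"
      using T t \<open>0 < s\<close> by (simp add: frac_le_eq divide_nonpos_pos)
  qed (use D in simp)
  also have "\<dots> = (f1 a b 0)\<^sup>2"
  proof -
    have "(cos a)\<^sup>2 = 1 / (1 + T\<^sup>2)" and cb: "(cos b)\<^sup>2 = 1 / (1 + t\<^sup>2)"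
      using F(8,9) D by (simp_all add: eq_divide_eq T_def t_def)
    then have "(sin a)\<^sup>2 = T\<^sup>2 / (1 + T\<^sup>2)" by (simp add: F(12) T_def power_mult_distrib)
    with cb show ?thesis by (simp add: f1_def power_divide power_mult_distrib T_def[symmetric] t_def[symmetric])
  qed
  finally show "sqrt (peak_sq (tan a) s) \<le> f1 a b 0"
    using f1_nonneg[OF ab, of 0] by (simp add: real_le_lsqrt T_def)
qed

text \<open>For \<open>0 \<le> r0 a b\<close> the ratio is a value of \<open>peak_sq\<close>.
  Otherwise extent 0 already yields at least the peak at \<open>s\<close>, which also lies in the
  range of the minimisation.\<close>

lemma hedge_ratio_ge_peak_minimum:
  assumes ab: "0 < a" "a < pi / 2" "b \<in> {0..a}"
  defines "T \<equiv> tan a"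
  shows "ereal (sqrt (peak_sq T (max 0 (min T (T * (3 - T\<^sup>2) / (1 + 5 * T\<^sup>2)))))) \<le> hedge_ratio a b"
proof -
  note F = cone_angle_facts[OF ab]
  have T: "0 < T" using F(4) by (simp add: T_def)
  show ?thesis
  proof (cases "0 \<le> r0 a b")
    case True
    then show ?thesis
      using hedge_ratio_eq_peak(1)[OF ab True] peak_sq_minimum[OF T, of "tan b"] F(5,6)
      by (simp add: T_def)
  next
    case False
    then have neg: "r0 a b < 0" by simp
    note P = peak_le_f1_zero[OF ab neg, folded T_def]
    have "- cos (2 * a) \<le> 0" using r0_bounds(1)[OF ab] neg by linarith
    then have "worst_ratio a b 0 = f1 a b 0" by (rule worst_ratio_eq_f1[OF ab])
    moreover have "ereal (worst_ratio a b 0) \<le> hedge_ratio a b"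
      by (rule hedge_ratio_ge_worst_ratio[OF ab]) simp
    ultimately have "ereal (f1 a b 0) \<le> hedge_ratio a b" by simp
    moreover have "sqrt (peak_sq T (max 0 (min T (T * (3 - T\<^sup>2) / (1 + 5 * T\<^sup>2))))) \<le> f1 a b 0"
      using peak_sq_minimum[OF T P(1)] P(2) by (meson order_trans real_sqrt_le_mono)
    ultimately show ?thesis by (meson ereal_less_eq(3) order_trans)
  qed
qed

section \<open>Closed forms of the optimal angle and ratio\<close>

text \<open>The right-hand side is \<open>cos (2 * arctan m)\<close>, so the middle branch of
  \<open>beta0\<close> is \<open>arctan m\<close>.\<close>

lemma cos_double_beta_middle:
  assumes a: "0 < a" "a < pi / 2"
  defines "m \<equiv> tan a * (3 - (tan a)\<^sup>2) / (1 + 5 * (tan a)\<^sup>2)"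
  shows "(- 2 * cos (4 * a) + cos (6 * a) + 2) / (3 - 2 * cos (4 * a)) = (1 - m\<^sup>2) / (1 + m\<^sup>2)"
proof -
  have F: "cos (2 * a) = (1 - (tan a)\<^sup>2) / (1 + (tan a)\<^sup>2)"
    using cone_angle_facts[of a a] a by simp
  define U c where "U = (tan a)\<^sup>2" and "c = cos (2 * a)"
  have U: "0 \<le> U" by (simp add: U_def)
  have c4: "cos (4 * a) = 2 * c\<^sup>2 - 1" using cos_double_cos[of "2 * a"] by (simp add: c_def)
  have c6: "cos (6 * a) = 4 * c ^ 3 - 3 * c" using cos_treble_cos[of "2 * a"] by (simp add: c_def)
  have c: "c = (1 - U) / (1 + U)" using F by (simp add: c_def U_def)
  have m2: "m\<^sup>2 = U * (3 - U)\<^sup>2 / (1 + 5 * U)\<^sup>2" by (simp add: m_def U_def power_divide power_mult_distrib)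
  have D: "0 < 1 + U" "0 < 1 + 5 * U" using U by auto
  have cU: "c * (1 + U) = 1 - U" using D by (simp add: c)
  \<comment> \<open>The cosines have degree at most 3 in \<open>c\<close>, so the factor
    \<open>(1 + U) ^ 3\<close> clears all denominators.\<close>
  have den: "(3 - 2 * cos (4 * a)) * (1 + U) ^ 3 = (1 + U) * (5 * (1 + U)\<^sup>2 - 4 * (1 - U)\<^sup>2)"
    unfolding c4 cU[symmetric] by (simp add: algebra_simps power_numeral_reduce)
  have num: "(- 2 * cos (4 * a) + cos (6 * a) + 2) * (1 + U) ^ 3
      = 4 * (1 - U) ^ 3 - 3 * (1 - U) * (1 + U)\<^sup>2 - 4 * (1 - U)\<^sup>2 * (1 + U) + 4 * (1 + U) ^ 3"
    unfolding c4 c6 cU[symmetric] by (simp add: algebra_simps power_numeral_reduce)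
  have "(- 2 * cos (4 * a) + cos (6 * a) + 2) / (3 - 2 * cos (4 * a))
     = (4 * (1 - U) ^ 3 - 3 * (1 - U) * (1 + U)\<^sup>2 - 4 * (1 - U)\<^sup>2 * (1 + U) + 4 * (1 + U) ^ 3)
       / ((1 + U) * (5 * (1 + U)\<^sup>2 - 4 * (1 - U)\<^sup>2))"
    unfolding den[symmetric] num[symmetric] using D by simp
  also have "\<dots> = ((1 + 5 * U)\<^sup>2 - U * (3 - U)\<^sup>2) / ((1 + 5 * U)\<^sup>2 + U * (3 - U)\<^sup>2)"
    by (rule arg_cong2[where f = "(/)"]) (simp_all add: algebra_simps power_numeral_reduce)
  also have "\<dots> = (1 - m\<^sup>2) / (1 + m\<^sup>2)"
    unfolding m2 using D by (simp add: divide_simps)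
  finally show ?thesis .
qed

text \<open>The branches of \<open>beta0\<close> are those of the projection:
  \<open>T \<le> m\<close> means \<open>a \<le> pi / 6\<close>, and \<open>m \<le> 0\<close> means
  \<open>pi / 3 \<le> a\<close>.\<close>

lemma beta0_range_and_tan:
  assumes a: "0 < a" "a < pi / 2"
  defines "T \<equiv> tan a"
  shows "beta0 a \<in> {0..a}"
    and "tan (beta0 a) = max 0 (min T (T * (3 - T\<^sup>2) / (1 + 5 * T\<^sup>2)))"
proof -
  define m where "m = T * (3 - T\<^sup>2) / (1 + 5 * T\<^sup>2)"
  have T: "0 < T" using a by (simp add: T_def tan_gt_zero)
  have D: "0 < 1 + 5 * T\<^sup>2" by (simp add: add_pos_nonneg)
  have Tm: "T \<le> m \<longleftrightarrow> T\<^sup>2 \<le> 1 / 3"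
  proof -
    have "T \<le> m \<longleftrightarrow> T * (1 + 5 * T\<^sup>2) \<le> T * (3 - T\<^sup>2)" using D by (simp add: m_def pos_le_divide_eq)
    also have "\<dots> \<longleftrightarrow> 1 + 5 * T\<^sup>2 \<le> 3 - T\<^sup>2" using T by simp
    finally show ?thesis by auto
  qed
  have m0: "0 \<le> m \<longleftrightarrow> T\<^sup>2 \<le> 3" using T D by (simp add: m_def zero_le_divide_iff zero_le_mult_iff)
  have low: "a \<le> pi / 6 \<longleftrightarrow> T\<^sup>2 \<le> 1 / 3"
  proof -
    have "a \<le> pi / 6 \<longleftrightarrow> T \<le> 1 / sqrt 3" using a unfolding T_def tan_30[symmetric]
      by (subst tan_mono_le_eq) auto
    also have "\<dots> \<longleftrightarrow> T\<^sup>2 \<le> (1 / sqrt 3)\<^sup>2" using T by (simp add: abs_le_square_iff[symmetric] del: power_divide)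
    finally show ?thesis by (simp add: power_divide)
  qed
  have high: "pi / 3 \<le> a \<longleftrightarrow> 3 \<le> T\<^sup>2"
  proof -
    have "pi / 3 \<le> a \<longleftrightarrow> sqrt 3 \<le> T" using a unfolding T_def tan_60[symmetric]
      by (subst tan_mono_le_eq) auto
    also have "\<dots> \<longleftrightarrow> (sqrt 3)\<^sup>2 \<le> T\<^sup>2" using T by (simp add: abs_le_square_iff[symmetric] del: real_sqrt_pow2)
    finally show ?thesis by simp
  qed
  have "beta0 a \<in> {0..a} \<and> tan (beta0 a) = max 0 (min T m)"
  proof -
    consider "a \<le> pi / 6" | "pi / 6 < a" "a < pi / 3" | "pi / 3 \<le> a" by linarith
    then show ?thesis
    proof cases
      case 1
      then have "beta0 a = a" "T \<le> m" using low Tm by (auto simp: beta0_def)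
      then show ?thesis using a T by (simp add: T_def)
    next
      case 2
      then have m: "0 \<le> m" "m \<le> T" using low high Tm m0 by linarith+
      have "beta0 a = arccos ((1 - m\<^sup>2) / (1 + m\<^sup>2)) / 2"
        using 2 cos_double_beta_middle[OF a] by (simp add: beta0_def m_def T_def)
      also have "(1 - m\<^sup>2) / (1 + m\<^sup>2) = cos (2 * arctan m)"
        using cos_tan_half[of "arctan m"] by (simp add: tan_arctan)
      also have "arccos (cos (2 * arctan m)) = 2 * arctan m"
        using m arctan_ubound[of m] by (intro arccos_cos) auto
      finally have b: "beta0 a = arctan m" by simp
      have "arctan m \<le> arctan T" using m by (simp add: arctan_le_iff)
      also have "\<dots> = a" using a by (simp add: T_def arctan_tan)
      finally show ?thesis using b m by (simp add: tan_arctan)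
    next
      case 3
      then have "T\<^sup>2 \<ge> 3" using high by simp
      then have "m \<le> 0" using T D by (simp add: m_def divide_nonpos_pos mult_nonneg_nonpos)
      then show ?thesis using 3 a by (simp add: beta0_def)
    qed
  qed
  then show "beta0 a \<in> {0..a}"
    and "tan (beta0 a) = max 0 (min T (T * (3 - T\<^sup>2) / (1 + 5 * T\<^sup>2)))" by (simp_all add: m_def)
qed

text \<open>The threshold at which \<open>r0\<close> vanishes is positive only for small
  \<open>a\<close>, but never exceeds \<open>m\<close> or \<open>T\<close>, hence never exceeds
  their clamped minimum.\<close>

lemma r0_beta0_nonneg:
  assumes a: "0 < a" "a < pi / 2"
  shows "0 \<le> r0 a (beta0 a)"
proof -
  define T where "T = tan a"
  define m where "m = T * (3 - T\<^sup>2) / (1 + 5 * T\<^sup>2)"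
  note B = beta0_range_and_tan[OF a, folded T_def, folded m_def]
  have T: "0 < T" using a by (simp add: T_def tan_gt_zero)
  have D: "0 < 1 + 5 * T\<^sup>2" "0 < 1 + 3 * T\<^sup>2" by (simp_all add: add_pos_nonneg)
  have "T * (1 - T\<^sup>2) / (1 + 3 * T\<^sup>2) \<le> m"
  proof -
    have "0 \<le> T * (2 + 4 * T\<^sup>2 + 2 * (T\<^sup>2 * T\<^sup>2))" using T by simp
    also have "\<dots> = T * (3 - T\<^sup>2) * (1 + 3 * T\<^sup>2) - T * (1 - T\<^sup>2) * (1 + 5 * T\<^sup>2)"
      by (simp add: algebra_simps)
    finally show ?thesis unfolding m_def using D by (simp add: frac_le_eq divide_nonpos_pos)
  qed
  moreover have "T * (1 - T\<^sup>2) / (1 + 3 * T\<^sup>2) \<le> T"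
    using D T by (simp add: pos_divide_le_eq algebra_simps)
  ultimately have "T * (1 - T\<^sup>2) / (1 + 3 * T\<^sup>2) \<le> tan (beta0 a)" unfolding B(2) by linarith
  then show ?thesis
    using r0_bounds(3)[OF a B(1)] D by (simp add: T_def[symmetric] pos_divide_le_eq)
qed

lemma rho_opt_eq_peak:
  assumes a: "0 < a" "a < pi / 2"
  shows "rho_opt a = sqrt (peak_sq (tan a) (tan (beta0 a)))"
proof -
  note B = beta0_range_and_tan[OF a]
  note F = cone_angle_facts[OF a B(1)]
  have c: "1 + (tan a)\<^sup>2 = (1 / cos a)\<^sup>2" using F(2,9) by (simp add: field_simps)
  consider "a < pi / 6" | "pi / 6 \<le> a" "a \<le> pi / 3" | "pi / 3 < a" by linarith
  then show ?thesis
  proof cases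
    case 1
    have "peak_sq (tan a) (tan a) = 1 + (tan a)\<^sup>2"
      using F(4) by (simp add: peak_sq_def power_mult_distrib power_numeral_reduce)
    then show ?thesis using 1 F(2) by (simp add: rho_opt_def beta0_def c)
  next
    case 2
    then show ?thesis using r0_bounds(4)[OF a B(1)] by (simp add: rho_opt_def)
  next
    case 3
    have "peak_sq (tan a) 0 = (1 + (tan a)\<^sup>2) / (tan a)\<^sup>2"
      using F(4) by (simp add: peak_sq_def field_simps power_numeral_reduce)
    also have "\<dots> = (1 / sin a)\<^sup>2" using F(2) by (simp add: c F(12) power_divide power_mult_distrib)
    finally have "peak_sq (tan a) 0 = (1 / sin a)\<^sup>2" .
    then have "sqrt (peak_sq (tan a) 0) = 1 / sin a" using F(1) by (simp only: real_sqrt_abs) simp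
    then show ?thesis using 3 a by (simp add: rho_opt_def beta0_def)
  qed
qed

theorem theorem3:
  fixes a :: real
  assumes "0 < a" and "a < pi / 2"
  shows "beta0 a \<in> {0..a}
    \<and> (\<forall>b\<in>{0..a}. hedge_ratio a (beta0 a) \<le> hedge_ratio a b)
    \<and> hedge_ratio a (beta0 a) = ereal (rho_opt a)
    \<and> r0 a (beta0 a) \<in> {0..1}
    \<and> hedge_ratio_at a (beta0 a) (r0 a (beta0 a)) = ereal (rho_opt a)
    \<and> (a \<le> pi / 6 \<longrightarrow> r0 a (beta0 a) = 1)
    \<and> (pi / 3 \<le> a \<longrightarrow> r0 a (beta0 a) = - cos (2 * a))"
proof -
  note B = beta0_range_and_tan[OF assms]
  note F = cone_angle_facts[OF assms B(1)]
  note r = r0_beta0_nonneg[OF assms]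
  note H = hedge_ratio_eq_peak[OF assms B(1) r]
  have "hedge_ratio a (beta0 a) \<le> hedge_ratio a b" if "b \<in> {0..a}" for b
    unfolding H(1) B(2) by (rule hedge_ratio_ge_peak_minimum[OF assms that])
  \<comment> \<open>For angle \<open>a\<close> the coefficient \<open>A\<close> in \<open>r0\<close>
    is 1, for angle 0 it is 0.\<close>
  moreover have "r0 a (beta0 a) = 1" if "a \<le> pi / 6"
    using that F(4,11) by (simp add: r0_eq beta0_def)
  moreover have "r0 a (beta0 a) = - cos (2 * a)" if "pi / 3 \<le> a"
    using that assms by (simp add: r0_eq beta0_def)
  ultimately show ?thesis
    using B(1) r r0_bounds(2)[OF assms B(1)] H by (simp add: rho_opt_eq_peak[OF assms])
qed

end
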